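(* Fix $T>0$ and let $x_U(t)$ be a solution of Utkin's equivalent control system $\dot x=f_U(x):=f(x,0;U(x))$, where $U(x)\in[-1,1]$ is defined by $g(x,0;U(x))=0$, and assume that $|x_U(t)|<M$ for $0\le t\le T$. Then there exist $\alpha_0>0$ and a constant $L>0$ such that, for any $0<\alpha\le\alpha_0$, any solution $(x(t),y(t))$ of the smooth system $$\dot x=f(x,y;\phi(y/\alpha)),\qquad \dot y=g(x,y;\phi(y/\alpha)),$$ with initial condition $(x(0),y(0))=(x_0,y_0)=(x_U(0),y_0)$, $y_0\in[-\alpha,\alpha]$, satisfies $$|x(t)-x_U(t)|\le L\alpha,\qquad 0\le t\le T.$$
   Context: Here $x\in\mathbb R^{n-1}$, $y\in\mathbb R$, and $f(x,y;u)$, $g(x,y;u)$ are smooth functions of $(x,y,u)$. Standing assumption: $M>0$ is such that, for all $|x|\le M$, $$g(x,0;+1)<0<g(x,0;-1)\quad\text{and}\quad \frac{\partial}{\partial u}g(x,0;u)<0\ \text{ for } u\in[-1,1]$$ (so that $U(x)$ is well defined for $|x|\le M$). The function $\phi:\mathbb R\to[-1,1]$ is a smooth sigmoid function with $\phi(w)=\mathrm{sign}(w)$ for $|w|>1$, $\phi(w)\in[-1,1]$ for $|w|\le1$, and $\phi'(w)>0$ for $|w|<1$. *)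

theory Defs
  imports "HOL-Analysis.Analysis"
begin

text \<open>
  For a finite-dimensional domain, \<open>C_diff k F\<close> below says that \<open>F\<close> is of class
  C^k on the whole space: at each stage \<open>F\<close> is Frechet differentiable and all its
  directional derivatives are again of the preceding class, down to continuity.
\<close>

primrec C_diff :: "nat \<Rightarrow> ('a::euclidean_space \<Rightarrow> 'b::real_normed_vector) \<Rightarrow> bool" where
  "C_diff 0 F \<longleftrightarrow> continuous_on UNIV F"
| "C_diff (Suc k) F \<longleftrightarrow>
     (\<forall>p. F differentiable (at p)) \<and> (\<forall>v. C_diff k (\<lambda>p. frechet_derivative F (at p) v))"

definition smooth :: "('a::euclidean_space \<Rightarrow> 'b::real_normed_vector) \<Rightarrow> bool" where
  "smooth F \<longleftrightarrow> (\<forall>k. C_diff k F)"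

definition sigmoid :: "(real \<Rightarrow> real) \<Rightarrow> bool" where
  "sigmoid \<phi> \<longleftrightarrow>
     smooth \<phi> \<and>
     (\<forall>w. \<bar>w\<bar> > 1 \<longrightarrow> \<phi> w = sgn w) \<and>
     (\<forall>w. \<bar>w\<bar> \<le> 1 \<longrightarrow> \<phi> w \<in> {-1..1}) \<and>
     (\<forall>w. \<bar>w\<bar> < 1 \<longrightarrow> deriv \<phi> w > 0)"

text \<open>
  The equivalent control U(x).  The description is meaningful only where the zero of
  \<open>\<lambda>u. g x 0 u\<close> in [-1,1] exists and is unique; this holds in the closed ball of radius
  \<open>M\<close> under \<open>sliding_assumption\<close> below.
\<close>

definition equivalent_control :: "('a \<Rightarrow> real \<Rightarrow> real \<Rightarrow> real) \<Rightarrow> 'a \<Rightarrow> real" where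
  "equivalent_control g x = (THE u. u \<in> {-1..1} \<and> g x 0 u = 0)"

definition utkin_field ::
    "('a \<Rightarrow> real \<Rightarrow> real \<Rightarrow> 'a) \<Rightarrow> ('a \<Rightarrow> real \<Rightarrow> real \<Rightarrow> real) \<Rightarrow> 'a \<Rightarrow> 'a" where
  "utkin_field f g x = f x 0 (equivalent_control g x)"

definition sliding_assumption ::
    "('a::real_normed_vector \<Rightarrow> real \<Rightarrow> real \<Rightarrow> real) \<Rightarrow> real \<Rightarrow> bool" where
  "sliding_assumption g M \<longleftrightarrow>
     (\<forall>x. norm x \<le> M \<longrightarrow>
        g x 0 1 < 0 \<and> 0 < g x 0 (-1) \<and> (\<forall>u\<in>{-1..1}. deriv (\<lambda>v. g x 0 v) u < 0))"

text \<open>Derivatives are taken within \<open>S\<close>, hence one-sided at the end points of an interval.\<close>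

definition ode_solution_on ::
    "('a::real_normed_vector \<Rightarrow> 'a) \<Rightarrow> (real \<Rightarrow> 'a) \<Rightarrow> real set \<Rightarrow> bool" where
  "ode_solution_on F z S \<longleftrightarrow> (\<forall>t\<in>S. (z has_vector_derivative F (z t)) (at t within S))"

definition regularized_field ::
    "('a \<Rightarrow> real \<Rightarrow> real \<Rightarrow> 'a) \<Rightarrow> ('a \<Rightarrow> real \<Rightarrow> real \<Rightarrow> real) \<Rightarrow> (real \<Rightarrow> real) \<Rightarrow> real
      \<Rightarrow> 'a \<times> real \<Rightarrow> 'a \<times> real" where
  "regularized_field f g \<phi> \<alpha> = (\<lambda>(x, y). (f x y (\<phi> (y / \<alpha>)), g x y (\<phi> (y / \<alpha>))))"

end

theory Submission
  imports Defs
begin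

text \<open>
  Let \<open>U t\<close> be the equivalent control along the sliding motion \<open>x\<^sub>U\<close> and let \<open>W t\<close> be a preimage of
  \<open>U t\<close> under \<open>\<phi>\<close>. In the regularized system \<open>y\<close> should settle near \<open>\<alpha> * W t\<close>, because there the
  applied control \<open>v = \<phi> (y / \<alpha>)\<close> equals \<open>U t\<close>. The proof measures both errors at once by
  \<open>m t = norm (x t - x\<^sub>U t) + A * \<bar>y t - \<alpha> * W t\<bar>\<close>.

  The first error grows at rate at most \<open>K * (m + \<alpha> + \<bar>v - U\<bar>)\<close>, where \<open>K\<close> is a Lipschitz constant
  of the fields. The term \<open>\<bar>v - U\<bar>\<close> need not be small: it is of order one during the initial layer.
  But \<open>g x 0\<close> decreases in the control at a uniform rate \<open>c > 0\<close> (lemma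
  \<open>sliding_strongly_decreasing\<close>), and \<open>\<phi>\<close> is monotone, so \<open>y\<close> is driven towards \<open>\<alpha> * W\<close> with
  speed at least \<open>c * \<bar>v - U\<bar>\<close> up to an error \<open>K * (m + \<alpha>)\<close>. The target itself moves with speed
  \<open>O(\<alpha>)\<close>, since \<open>W\<close> is Lipschitz in time (lemmas \<open>equivalent_control_lipschitz\<close> and
  \<open>sigmoid_lipschitz_inverse\<close>). If \<open>A * c\<close> is at least \<open>K\<close>, the terms with \<open>\<bar>v - U\<bar>\<close> cancel, and
  \<open>m\<close> grows at rate at most \<open>\<Lambda> * m + B * \<alpha>\<close>. As \<open>m 0\<close> is at most \<open>2 * A * \<alpha>\<close>, a Gronwall
  argument gives \<open>m \<le> L * \<alpha>\<close>. In this way the fast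
  motion of \<open>y\<close> in the initial layer pays for the error in \<open>x\<close> that it causes.

  The norm is not differentiable at 0 and \<open>W\<close> is merely Lipschitz, so the rates are one-sided (lemma
  \<open>dini_gronwall\<close>). The estimates hold only while \<open>m < 1\<close>, which confines the solution to a compact
  set on which the fields are Lipschitz; choosing \<open>\<alpha>\<^sub>0\<close> with \<open>L * \<alpha>\<^sub>0 < 1\<close> makes this self-consistent.
\<close>

section \<open>One-sided growth rates\<close>

text \<open>
  A Gronwall inequality for functions that are merely continuous, with the growth rate controlled
  from the right. The rate is only known while \<open>m\<close> stays below \<open>R\<close>, so that a solution may be
  compared with a reference curve by estimates valid near that curve. The barrier condition says
  that the resulting bound itself stays below \<open>R\<close>, which closes the continuity argument: at the last
  time \<open>r\<close> at which \<open>m\<close> is below the bound, the rate hypothesis applies and keeps \<open>m\<close> below it a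
  little longer.
\<close>

lemma dini_gronwall:
  fixes m :: "real \<Rightarrow> real"
  assumes cont: "continuous_on {0..\<tau>} m"
    and nonneg: "0 \<le> \<Lambda>" "0 \<le> B" "0 \<le> a"
    and init: "m 0 \<le> a"
    and barrier: "(a + B * \<tau>) * exp (\<Lambda> * \<tau>) < R"
    and dini: "\<And>t. 0 \<le> t \<Longrightarrow> t < \<tau> \<Longrightarrow> m t < R \<Longrightarrow>
        \<forall>\<^sub>F s in at_right t. m s \<le> m t + (\<Lambda> * m t + B) * (s - t)"
    and t: "t \<in> {0..\<tau>}"
  shows "m t \<le> (a + B * t) * exp (\<Lambda> * t)"
proof (rule ccontr)
  define b where "b s = (a + B * s) * exp (\<Lambda> * s)" for s
  assume "\<not> m t \<le> (a + B * t) * exp (\<Lambda> * t)"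
  then have above: "b t < m t" by (simp add: b_def)
  define S where "S = {s \<in> {0..t}. m s \<le> b s}"
  have "continuous_on {0..t} m"
    using cont by (rule continuous_on_subset) (use t in auto)
  then have "closed S"
    unfolding S_def b_def by (intro continuous_on_closed_Collect_le continuous_intros) auto
  moreover have "S \<subseteq> {0..t}" by (auto simp: S_def)
  ultimately have "compact S"
    using compact_Int_closed[OF compact_Icc, of S 0 t] by (simp add: Int_absorb1)
  moreover have "0 \<in> S" using init t by (simp add: S_def b_def)
  ultimately obtain r where r: "r \<in> S" and last: "\<And>s. s \<in> S \<Longrightarrow> s \<le> r"
    using compact_attains_sup[of S] by blast
  have r': "0 \<le> r" "r < t" "m r \<le> b r"
    using r above by (auto simp: S_def order_le_less)
  have "b r \<le> (a + B * \<tau>) * exp (\<Lambda> * \<tau>)"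
    unfolding b_def using nonneg r' t
    by (intro mult_mono add_left_mono mult_left_mono) (auto intro!: mult_left_mono)
  then have "m r < R" using r' barrier by linarith
  then have "\<forall>\<^sub>F s in at_right r. m s \<le> m r + (\<Lambda> * m r + B) * (s - r)"
    using dini r' t by auto
  moreover have "\<forall>\<^sub>F s in at_right r. s \<in> {r<..<t}"
    using r' by (intro eventually_at_right_real)
  ultimately have "\<forall>\<^sub>F s in at_right r. s \<in> {r<..<t} \<and> m s \<le> m r + (\<Lambda> * m r + B) * (s - r)"
    by eventually_elim auto
  then obtain s where s: "r < s" "s < t" "m s \<le> m r + (\<Lambda> * m r + B) * (s - r)"
    using eventually_happens'[OF trivial_limit_at_right_real] by fastforce
  let ?d = "s - r"
  have "m s \<le> b r + (\<Lambda> * b r + B) * ?d"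
  proof -
    have "\<Lambda> * m r \<le> \<Lambda> * b r" using r' nonneg by (intro mult_left_mono)
    then have "(\<Lambda> * m r + B) * ?d \<le> (\<Lambda> * b r + B) * ?d" using s by (intro mult_right_mono) auto
    then show ?thesis using s r' by linarith
  qed
  also have "\<dots> \<le> (b r + B * ?d) * (1 + \<Lambda> * ?d)"
  proof -
    have "0 \<le> B * ?d * (\<Lambda> * ?d)" using nonneg s by simp
    then have "b r + (\<Lambda> * b r + B) * ?d \<le> b r + (\<Lambda> * b r + B) * ?d + B * ?d * (\<Lambda> * ?d)"
      by simp
    also have "\<dots> = (b r + B * ?d) * (1 + \<Lambda> * ?d)"
      by (simp only: distrib_left distrib_right mult_1_right mult.assoc mult.commute mult.left_commute add_ac)
    finally show ?thesis .
  qed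
  also have "\<dots> \<le> ((a + B * r) * exp (\<Lambda> * r) + (B * ?d) * exp (\<Lambda> * r)) * exp (\<Lambda> * ?d)"
  proof (rule mult_mono)
    have "1 \<le> exp (\<Lambda> * r)" using nonneg r' by simp
    then have "B * ?d * 1 \<le> B * ?d * exp (\<Lambda> * r)" using nonneg s by (intro mult_left_mono) auto
    then show "b r + B * ?d \<le> (a + B * r) * exp (\<Lambda> * r) + (B * ?d) * exp (\<Lambda> * r)"
      by (simp add: b_def)
  qed (use nonneg s r' in \<open>auto simp: exp_ge_add_one_self\<close>)
  also have "\<dots> = (a + B * s) * (exp (\<Lambda> * r) * exp (\<Lambda> * ?d))"
    by (simp add: algebra_simps)
  also have "\<dots> = b s" by (simp add: b_def flip: exp_add) (simp add: algebra_simps)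
  finally have "s \<in> S" using s r' by (simp add: S_def)
  then show False using last s by force
qed

text \<open>
  First-order expansion to the right, in the form in which it produces one-sided rates of growth.
\<close>

lemma has_vector_derivative_eventually_at_right:
  fixes e :: "real \<Rightarrow> 'a::real_normed_vector"
  assumes e: "(e has_vector_derivative d) (at t within {t..\<tau>})" and "t < \<tau>" and "\<epsilon> > 0"
  shows "\<forall>\<^sub>F s in at_right t. norm (e s - e t - (s - t) *\<^sub>R d) \<le> \<epsilon> * (s - t)"
proof -
  have "\<forall>\<^sub>F s in at_right t. norm (e s - e t - (s - t) *\<^sub>R d) / norm (s - t) < \<epsilon>"
    using e \<open>\<epsilon> > 0\<close> unfolding has_vector_derivative_def has_derivative_within
      at_within_Icc_at_right[OF \<open>t < \<tau>\<close>]
    by (auto dest!: tendstoD[of _ _ _ \<epsilon>] simp: divide_inverse mult.commute diff_diff_eq)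
  then show ?thesis
    using eventually_at_right_less[of t] by eventually_elim (simp add: field_simps)
qed

lemma norm_eventually_le_at_right:
  fixes e :: "real \<Rightarrow> 'a::real_normed_vector"
  assumes e: "(e has_vector_derivative d) (at t within {t..\<tau>})" and "t < \<tau>" and "\<epsilon> > 0"
    and d: "norm d \<le> D"
  shows "\<forall>\<^sub>F s in at_right t. norm (e s) \<le> norm (e t) + (D + \<epsilon>) * (s - t)"
  using has_vector_derivative_eventually_at_right[OF assms(1-3)] eventually_at_right_less[of t]
proof eventually_elim
  case (elim s)
  have "norm (e s) \<le> norm (e s - e t - (s - t) *\<^sub>R d) + (norm (e t) + norm ((s - t) *\<^sub>R d))"
    using norm_triangle_ineq[of "e s - e t - (s - t) *\<^sub>R d" "e t + (s - t) *\<^sub>R d"]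
      norm_triangle_ineq[of "e t" "(s - t) *\<^sub>R d"] by simp
  also have "norm ((s - t) *\<^sub>R d) \<le> (s - t) * D"
    using d elim by (auto intro: mult_left_mono)
  finally show ?case using elim by (simp add: algebra_simps)
qed

text \<open>
  The rate of growth of the distance between a differentiable curve \<open>y\<close> and a moving target \<open>V\<close>
  that is only Lipschitz. Away from the target only the component of the velocity pointing away
  from it counts, so an attracting field yields a negative \<open>\<beta>\<close>; the motion of the target costs
  its Lipschitz constant.
\<close>

lemma abs_diff_eventually_le_at_right:
  fixes y V :: "real \<Rightarrow> real"
  assumes y: "(y has_vector_derivative d) (at t within {t..\<tau>})" and "t < \<tau>" and "\<epsilon> > 0"
    and V: "\<And>s. s \<in> {t..\<tau>} \<Longrightarrow> \<bar>V s - V t\<bar> \<le> Q * (s - t)"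
    and above: "V t < y t \<Longrightarrow> d \<le> \<beta>"
    and below: "y t < V t \<Longrightarrow> - d \<le> \<beta>"
    and equal: "y t = V t \<Longrightarrow> \<bar>d\<bar> \<le> \<beta>"
  shows "\<forall>\<^sub>F s in at_right t. \<bar>y s - V s\<bar> \<le> \<bar>y t - V t\<bar> + (\<beta> + Q + \<epsilon>) * (s - t)"
proof -
  have lin: "\<forall>\<^sub>F s in at_right t. \<bar>y s - y t - (s - t) * d\<bar> \<le> \<epsilon> * (s - t)"
    using has_vector_derivative_eventually_at_right[OF y \<open>t < \<tau>\<close> \<open>\<epsilon> > 0\<close>] by simp
  have inside: "\<forall>\<^sub>F s in at_right t. s \<in> {t<..<\<tau>}"
    using \<open>t < \<tau>\<close> by (rule eventually_at_right_real)
  have drift: "\<forall>\<^sub>F s in at_right t. \<bar>V s - V t\<bar> \<le> Q * (s - t)"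
    using inside by eventually_elim (auto intro: V)
  have y_lim: "(y \<longlongrightarrow> y t) (at_right t)"
    using has_vector_derivative_continuous[OF y] at_within_Icc_at_right[OF \<open>t < \<tau>\<close>]
    by (simp add: continuous_within)
  have V_lim: "(V \<longlongrightarrow> V t) (at_right t)"
  proof (rule tendsto_dist_iff[THEN iffD2], rule tendsto_sandwich)
    show "\<forall>\<^sub>F s in at_right t. 0 \<le> dist (V s) (V t)" by simp
    show "\<forall>\<^sub>F s in at_right t. dist (V s) (V t) \<le> Q * (s - t)"
      using drift by (simp add: dist_real_def)
    have "((\<lambda>s. Q * (s - t)) \<longlongrightarrow> Q * (t - t)) (at_right t)" by (intro tendsto_intros)
    then show "((\<lambda>s. Q * (s - t)) \<longlongrightarrow> 0) (at_right t)" by simp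
  qed (rule tendsto_const)
  have lim: "((\<lambda>s. y s - V s) \<longlongrightarrow> y t - V t) (at_right t)"
    by (intro tendsto_diff y_lim V_lim)
  consider "V t < y t" | "y t < V t" | "y t = V t" by linarith
  then show ?thesis
  proof cases
    case 1
    then have "\<forall>\<^sub>F s in at_right t. 0 < y s - V s"
      by (intro order_tendstoD(1)[OF lim]) simp
    with lin drift inside show ?thesis
    proof eventually_elim
      case (elim s)
      have "(s - t) * d \<le> (s - t) * \<beta>" using above[OF 1] elim by (intro mult_left_mono) auto
      with elim 1 show ?case by (simp add: algebra_simps)
    qed
  next
    case 2
    then have "\<forall>\<^sub>F s in at_right t. y s - V s < 0"
      by (intro order_tendstoD(2)[OF lim]) simp
    with lin drift inside show ?thesis
    proof eventually_elim
      case (elim s)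
      have "(s - t) * (- d) \<le> (s - t) * \<beta>" using below[OF 2] elim by (intro mult_left_mono) auto
      with elim 2 show ?case by (simp add: algebra_simps)
    qed
  next
    case 3
    from lin drift inside show ?thesis
    proof eventually_elim
      case (elim s)
      have "\<bar>(s - t) * d\<bar> \<le> (s - t) * \<beta>"
        using equal[OF 3] elim by (auto simp: abs_mult intro: mult_left_mono)
      with elim 3 show ?case by (simp add: algebra_simps)
    qed
  qed
qed

lemma lipschitz_if_bounded_derivative:
  fixes e :: "real \<Rightarrow> 'a::real_normed_vector"
  assumes e: "\<And>t. t \<in> {a..b} \<Longrightarrow> (e has_vector_derivative d t) (at t within {a..b})"
    and d: "\<And>t. t \<in> {a..b} \<Longrightarrow> norm (d t) \<le> C"
    and st: "s \<in> {a..b}" "t \<in> {a..b}"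
  shows "norm (e s - e t) \<le> C * \<bar>s - t\<bar>"
proof -
  have "onorm (\<lambda>h. h *\<^sub>R d r) \<le> C" if "r \<in> {a..b}" for r
  proof (rule onorm_le)
    fix h :: real
    show "norm (h *\<^sub>R d r) \<le> C * norm h"
      using mult_left_mono[OF d[OF that], of "\<bar>h\<bar>"] by (simp add: mult.commute)
  qed
  then show ?thesis
    using differentiable_bound[of "{a..b}" e "\<lambda>r h. h *\<^sub>R d r" C s t] e st
    by (simp add: has_vector_derivative_def)
qed

section \<open>Smooth functions\<close>

lemma smooth_imp_differentiable: "smooth F \<Longrightarrow> F differentiable (at p)"
  unfolding smooth_def by (metis C_diff.simps(2))

lemma smooth_imp_continuous_derivative:
  assumes "smooth F"
  shows "continuous_on S (\<lambda>p. frechet_derivative F (at p) v)"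
proof -
  have "C_diff (Suc 0) F" using assms by (simp add: smooth_def)
  then show ?thesis by (auto intro: continuous_on_subset)
qed

lemma smooth_imp_continuous_on: "smooth F \<Longrightarrow> continuous_on S F"
  by (meson continuous_at_imp_continuous_on differentiable_imp_continuous_within
      smooth_imp_differentiable)

text \<open>
  The partial derivatives along the basis vectors are bounded on the compact set, and together they
  bound the operator norm of the derivative; the mean value inequality does the rest.
\<close>

lemma smooth_imp_lipschitz_on_compact_convex:
  fixes F :: "'a::euclidean_space \<Rightarrow> 'b::real_normed_vector"
  assumes F: "smooth F" and "compact S" "convex S"
  obtains K where "K > 0" "\<And>p q. p \<in> S \<Longrightarrow> q \<in> S \<Longrightarrow> norm (F p - F q) \<le> K * norm (p - q)"
proof -
  let ?D = "\<lambda>p. frechet_derivative F (at p)"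
  have "\<exists>C. \<forall>p\<in>S. norm (?D p b) \<le> C" for b
    using compact_imp_bounded[OF compact_continuous_image[OF
        smooth_imp_continuous_derivative[OF F] \<open>compact S\<close>, of b]]
    by (auto simp: bounded_iff)
  then obtain C where C: "\<And>b p. p \<in> S \<Longrightarrow> norm (?D p b) \<le> C b" by metis
  define K where "K = 1 + (\<Sum>b\<in>Basis. \<bar>C b\<bar>)"
  have "onorm (?D p) \<le> K" if "p \<in> S" for p
  proof (rule onorm_le)
    fix v
    have lin: "linear (?D p)"
      using smooth_imp_differentiable[OF F] by (rule linear_frechet_derivative)
    have "?D p v = (\<Sum>b\<in>Basis. (v \<bullet> b) *\<^sub>R ?D p b)"
      by (subst euclidean_representation[of v, symmetric])
        (simp add: linear_sum[OF lin] linear_cmul[OF lin])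
    also have "norm \<dots> \<le> (\<Sum>b\<in>Basis. \<bar>C b\<bar> * norm v)"
    proof (rule sum_norm_le)
      fix b :: 'a assume "b \<in> Basis"
      then have "\<bar>v \<bullet> b\<bar> \<le> norm v" by (rule Basis_le_norm)
      moreover have "norm (?D p b) \<le> \<bar>C b\<bar>" using C[OF that, of b] by linarith
      ultimately have "\<bar>v \<bullet> b\<bar> * norm (?D p b) \<le> norm v * \<bar>C b\<bar>"
        by (intro mult_mono) auto
      then show "norm ((v \<bullet> b) *\<^sub>R ?D p b) \<le> \<bar>C b\<bar> * norm v"
        by (simp add: mult.commute)
    qed
    also have "\<dots> \<le> K * norm v"
      by (simp add: K_def algebra_simps sum_distrib_left)
    finally show "norm (?D p v) \<le> K * norm v" .
  qed
  moreover have "(F has_derivative ?D p) (at p within S)" if "p \<in> S" for p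
    using smooth_imp_differentiable[OF F] frechet_derivative_works has_derivative_at_withinI by blast
  ultimately have "norm (F p - F q) \<le> K * norm (p - q)" if "p \<in> S" "q \<in> S" for p q
    using differentiable_bound[OF \<open>convex S\<close>, of F ?D K p q] that by blast
  moreover have "K > 0" by (simp add: K_def add_pos_nonneg sum_nonneg)
  ultimately show ?thesis using that by blast
qed

section \<open>The equivalent control\<close>

text \<open>
  Compactness makes the sign condition on the \<open>u\<close>-derivative uniform: \<open>- c\<close> is its maximum over
  the ball times the control interval. This \<open>c\<close> is the strength with which the sliding surface
  attracts.
\<close>

lemma sliding_strongly_decreasing:
  fixes g :: "'a::euclidean_space \<Rightarrow> real \<Rightarrow> real \<Rightarrow> real"
  assumes G: "smooth (\<lambda>(x, y, u). g x y u)" and "M > 0" and sl: "sliding_assumption g M"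
  obtains c where "c > 0"
    "\<And>x u v. norm x \<le> M \<Longrightarrow> -1 \<le> u \<Longrightarrow> u \<le> v \<Longrightarrow> v \<le> 1 \<Longrightarrow>
       g x 0 v \<le> g x 0 u - c * (v - u)"
proof -
  let ?G = "\<lambda>(x, y, u). g x y u"
  define D where "D x u = frechet_derivative ?G (at (x, 0, u)) (0, 0, 1)" for x u
  have D: "((\<lambda>v. g x 0 v) has_real_derivative D x u) (at u)" for x u
  proof -
    have "((\<lambda>v. (x, 0, v)) has_derivative (\<lambda>h. (0, 0, h))) (at u)"
      by (auto intro!: derivative_eq_intros)
    moreover have "(?G has_derivative frechet_derivative ?G (at (x, 0, u))) (at (x, 0, u))"
      using smooth_imp_differentiable[OF G] frechet_derivative_works by blast
    ultimately have "((\<lambda>v. ?G (x, 0, v)) has_derivative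
        (\<lambda>h. frechet_derivative ?G (at (x, 0, u)) (0, 0, h))) (at u)"
      by (rule has_derivative_compose)
    moreover have "frechet_derivative ?G (at (x, 0, u)) (0, 0, h) = D x u * h" for h
    proof -
      have "linear (frechet_derivative ?G (at (x, 0, u)))"
        using smooth_imp_differentiable[OF G] by (rule linear_frechet_derivative)
      from linear_cmul[OF this, of h "(0, 0, 1)"] show ?thesis by (simp add: D_def)
    qed
    ultimately show ?thesis by (simp add: has_field_derivative_def)
  qed
  let ?S = "cball (0::'a) M \<times> {-1..1::real}"
  have "continuous_on ?S (\<lambda>(x, u). D x u)"
  proof -
    have "continuous_on ?S (\<lambda>p. frechet_derivative ?G (at (fst p, 0, snd p)) (0, 0, 1))"
      by (rule continuous_on_compose2[OF smooth_imp_continuous_derivative[OF G, of UNIV]])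
        (auto intro!: continuous_intros)
    then show ?thesis by (simp add: D_def case_prod_beta)
  qed
  moreover have "compact ?S" by (intro compact_Times compact_cball compact_Icc)
  moreover have "(0, 0) \<in> ?S" using \<open>M > 0\<close> by simp
  ultimately obtain p where p: "p \<in> ?S" "\<forall>q\<in>?S. (\<lambda>(x, u). D x u) q \<le> (\<lambda>(x, u). D x u) p"
    using continuous_attains_sup[of ?S "\<lambda>(x, u). D x u"] by blast
  define c where "c = - (\<lambda>(x, u). D x u) p"
  have "c > 0"
    using p(1) sl DERIV_imp_deriv[OF D] by (auto simp: sliding_assumption_def c_def)
  moreover have "g x 0 v \<le> g x 0 u - c * (v - u)"
    if "norm x \<le> M" "-1 \<le> u" "u \<le> v" "v \<le> 1" for x u v
  proof (cases "u = v")
    case False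
    then have "u < v" using that by simp
    then obtain z where z: "u < z" "z < v" "g x 0 v - g x 0 u = (v - u) * D x z"
      using MVT2[of u v "\<lambda>v. g x 0 v" "D x"] D by blast
    have "D x z \<le> - c" using p(2) that z by (auto simp: c_def)
    then have "(v - u) * D x z \<le> (v - u) * (- c)" using \<open>u < v\<close> by (intro mult_left_mono) auto
    then show ?thesis using z by (simp add: algebra_simps)
  qed simp
  ultimately show ?thesis using that by blast
qed

text \<open>
  The intermediate value theorem gives a zero of \<open>g x 0\<close>, strict monotonicity makes it the only
  one, and the signs of \<open>g x 0\<close> at the end points keep it away from \<open>\<plusminus>1\<close>.
\<close>

lemma equivalent_control_sliding:
  fixes g :: "'a::euclidean_space \<Rightarrow> real \<Rightarrow> real \<Rightarrow> real"
  assumes G: "smooth (\<lambda>(x, y, u). g x y u)" and "M > 0" and sl: "sliding_assumption g M"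
    and x: "norm x \<le> M"
  shows "equivalent_control g x \<in> {-1<..<1}" "g x 0 (equivalent_control g x) = 0"
proof -
  obtain c where c: "c > 0"
    "\<And>x u v. norm x \<le> M \<Longrightarrow> -1 \<le> u \<Longrightarrow> u \<le> v \<Longrightarrow> v \<le> 1 \<Longrightarrow> g x 0 v \<le> g x 0 u - c * (v - u)"
    using sliding_strongly_decreasing[OF G \<open>M > 0\<close> sl] by blast
  have ends: "g x 0 1 < 0" "0 < g x 0 (-1)"
    using sl x by (auto simp: sliding_assumption_def)
  have "continuous_on {-1..1} (\<lambda>u. (\<lambda>(x, y, u). g x y u) (x, 0, u))"
    by (rule continuous_on_compose2[OF smooth_imp_continuous_on[OF G, of UNIV]])
      (auto intro!: continuous_intros)
  then obtain u where u: "-1 \<le> u" "u \<le> 1" "g x 0 u = 0"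
    using IVT2'[of "\<lambda>u. g x 0 u" 1 0 "-1"] ends by auto
  have less: "g x 0 w < g x 0 v" if "-1 \<le> v" "v < w" "w \<le> 1" for v w
    using c(2)[OF x, of v w] that mult_pos_pos[OF c(1), of "w - v"] by linarith
  have uniq: "v = u" if "v \<in> {-1..1} \<and> g x 0 v = 0" for v
  proof (rule ccontr)
    assume "v \<noteq> u"
    then consider "u < v" | "v < u" by linarith
    then show False
      by cases (use less[of u v] less[of v u] u that in \<open>simp_all\<close>)
  qed
  have "equivalent_control g x = u"
    unfolding equivalent_control_def
  proof (rule the_equality)
    show "u \<in> {-1..1} \<and> g x 0 u = 0" using u by simp
  qed (rule uniq)
  moreover have "u \<noteq> 1" "u \<noteq> -1" using u ends by auto
  ultimately show "equivalent_control g x \<in> {-1<..<1}" "g x 0 (equivalent_control g x) = 0"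
    using u by auto
qed

text \<open>
  A quantitative substitute for the implicit function theorem: moving from the zero at \<open>x\<close> to the
  zero at \<open>x'\<close> changes \<open>g x 0\<close> at rate at least \<open>c\<close>, while the total change is at most the
  Lipschitz constant of \<open>g\<close> times the distance of \<open>x\<close> and \<open>x'\<close>.
\<close>

lemma equivalent_control_lipschitz:
  fixes g :: "'a::euclidean_space \<Rightarrow> real \<Rightarrow> real \<Rightarrow> real"
  assumes G: "smooth (\<lambda>(x, y, u). g x y u)" and "M > 0" and sl: "sliding_assumption g M"
  obtains Q where "Q > 0" "\<And>x x'. norm x \<le> M \<Longrightarrow> norm x' \<le> M \<Longrightarrow>
    \<bar>equivalent_control g x - equivalent_control g x'\<bar> \<le> Q * norm (x - x')"
proof -
  let ?U = "equivalent_control g"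
  note U = equivalent_control_sliding[OF G \<open>M > 0\<close> sl]
  obtain c where c: "c > 0"
    "\<And>x u v. norm x \<le> M \<Longrightarrow> -1 \<le> u \<Longrightarrow> u \<le> v \<Longrightarrow> v \<le> 1 \<Longrightarrow> g x 0 v \<le> g x 0 u - c * (v - u)"
    using sliding_strongly_decreasing[OF G \<open>M > 0\<close> sl] by blast
  let ?S = "cball (0::'a) M \<times> {0::real} \<times> {-1..1::real}"
  have "compact ?S" "convex ?S"
    by (auto intro!: compact_Times convex_Times)
  then obtain K where K: "K > 0" and lip: "\<And>p q. p \<in> ?S \<Longrightarrow> q \<in> ?S \<Longrightarrow>
      norm ((\<lambda>(x, y, u). g x y u) p - (\<lambda>(x, y, u). g x y u) q) \<le> K * norm (p - q)"
    using smooth_imp_lipschitz_on_compact_convex[OF G] by metis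
  have le: "?U x' - ?U x \<le> K / c * norm (x - x')"
    if x: "norm x \<le> M" "norm x' \<le> M" and ord: "?U x \<le> ?U x'" for x x'
  proof -
    have "c * (?U x' - ?U x) \<le> g x 0 (?U x) - g x 0 (?U x')"
      using c(2)[OF x(1), of "?U x" "?U x'"] U(1)[OF x(1)] U(1)[OF x(2)] ord by auto
    also have "\<dots> = g x' 0 (?U x') - g x 0 (?U x')" using U(2) x by simp
    also have "\<dots> \<le> norm (g x 0 (?U x') - g x' 0 (?U x'))" by simp
    also have "\<dots> \<le> K * norm ((x, 0::real, ?U x') - (x', 0, ?U x'))"
      using lip[of "(x, 0, ?U x')" "(x', 0, ?U x')"] U(1)[OF x(2)] x by auto
    also have "\<dots> = K * norm (x - x')" by (simp add: norm_Pair)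
    finally show ?thesis using c(1) by (simp add: field_simps)
  qed
  have "\<bar>?U x - ?U x'\<bar> \<le> K / c * norm (x - x')" if "norm x \<le> M" "norm x' \<le> M" for x x'
    using le[of x x'] le[of x' x] that by (cases "?U x \<le> ?U x'") (auto simp: norm_minus_commute)
  then show ?thesis using that[of "K / c"] K c(1) by simp
qed

section \<open>The sigmoid function\<close>

text \<open>
  The values at \<open>\<plusminus>1\<close> come from continuity, since \<open>\<phi>\<close> is constant beyond these points. So \<open>\<phi>\<close>
  attains an extreme value at every point outside \<open>(-1,1)\<close>; its derivative vanishes there, and hence \<open>\<phi>\<close> is nondecreasing on the whole line.
\<close>

lemma sigmoid_properties:
  assumes "sigmoid \<phi>"
  shows "\<phi> w \<in> {-1..1}" "continuous_on S \<phi>" "\<phi> (-1) = -1" "\<phi> 1 = 1"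
    "(\<phi> has_real_derivative deriv \<phi> w) (at w)" "continuous_on S (deriv \<phi>)"
    "mono \<phi>"
proof -
  have sm: "smooth \<phi>" using assms by (simp add: sigmoid_def)
  have out: "\<phi> w = sgn w" if "\<bar>w\<bar> > 1" for w using assms that by (simp add: sigmoid_def)
  have rng: "\<phi> w \<in> {-1..1}" for w
  proof (cases "\<bar>w\<bar> \<le> 1")
    case True
    then show ?thesis using assms unfolding sigmoid_def by blast
  next
    case False
    then show ?thesis using out[of w] by (simp add: sgn_if)
  qed
  then show "\<phi> w \<in> {-1..1}" .
  have cont: "continuous_on A \<phi>" for A by (rule smooth_imp_continuous_on[OF sm])
  then show "continuous_on S \<phi>" .
  have der: "(\<phi> has_real_derivative deriv \<phi> w) (at w)" for w
    using smooth_imp_differentiable[OF sm] DERIV_deriv_iff_real_differentiable by blast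
  then show "(\<phi> has_real_derivative deriv \<phi> w) (at w)" .
  have "deriv \<phi> w = frechet_derivative \<phi> (at w) 1" for w
    using frechet_derivative_at[OF der[of w, unfolded has_field_derivative_def], symmetric] by simp
  then have "deriv \<phi> = (\<lambda>w. frechet_derivative \<phi> (at w) 1)" ..
  then show "continuous_on S (deriv \<phi>)"
    using smooth_imp_continuous_derivative[OF sm] by simp
  have lim: "(\<phi> \<longlongrightarrow> \<phi> w) (at w within A)" for w A
    using cont[of UNIV] by (simp add: continuous_on_def) (meson tendsto_within_subset subset_UNIV)
  show p1: "\<phi> 1 = 1"
  proof (rule tendsto_unique[OF trivial_limit_at_right_real lim])
    have "\<forall>\<^sub>F w in at_right 1. \<phi> w = 1"
      using eventually_at_right_less[of "1::real"] by eventually_elim (simp add: out)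
    then show "(\<phi> \<longlongrightarrow> 1) (at_right 1)" by (rule tendsto_eventually)
  qed
  show m1: "\<phi> (-1) = -1"
  proof (rule tendsto_unique[OF trivial_limit_at_left_real lim])
    have "\<forall>\<^sub>F w in at_left (-1). \<phi> w = -1"
      using eventually_at_left_real[of "-2" "-1"] by (auto elim!: eventually_mono simp: out)
    then show "(\<phi> \<longlongrightarrow> -1) (at_left (-1))" by (rule tendsto_eventually)
  qed
  have "deriv \<phi> w \<ge> 0" for w
  proof -
    consider "\<bar>w\<bar> < 1" | "w = 1" | "w = -1" | "w > 1" | "w < -1" by linarith
    then show ?thesis
    proof cases
      case 1
      then show ?thesis using assms by (simp add: sigmoid_def less_imp_le)
    next
      case 2
      have "deriv \<phi> 1 = 0"
        by (rule DERIV_local_max[OF der, of 1]) (use rng p1 in auto)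
      then show ?thesis using 2 by simp
    next
      case 3
      have "deriv \<phi> (-1) = 0"
        by (rule DERIV_local_min[OF der, of 1]) (use rng m1 in auto)
      then show ?thesis using 3 by simp
    next
      case 4
      have "deriv \<phi> w = 0"
        by (rule DERIV_local_max[OF der, of 1]) (use rng out[of w] 4 in auto)
      then show ?thesis by simp
    next
      case 5
      have "deriv \<phi> w = 0"
        by (rule DERIV_local_min[OF der, of 1]) (use rng out[of w] 5 in auto)
      then show ?thesis by simp
    qed
  qed
  then show "mono \<phi>"
    by (intro monoI) (metis DERIV_nonneg_imp_nondecreasing der)
qed

text \<open>
  The derivative of \<open>\<phi>\<close> vanishes at \<open>\<plusminus>1\<close>, so the inverse is Lipschitz only away from the
  extreme values. Over a compact subset of the open interval the preimages lie in a closed interval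
  inside \<open>(-1,1)\<close>, on which the derivative has a positive minimum.
\<close>

lemma sigmoid_lipschitz_inverse:
  assumes \<phi>: "sigmoid \<phi>" and S: "compact S" "S \<subseteq> {-1<..<1}"
  obtains \<psi> Q where "Q > 0" "\<And>u. u \<in> S \<Longrightarrow> \<psi> u \<in> {-1..1}" "\<And>u. u \<in> S \<Longrightarrow> \<phi> (\<psi> u) = u"
    "\<And>u v. u \<in> S \<Longrightarrow> v \<in> S \<Longrightarrow> \<bar>\<psi> u - \<psi> v\<bar> \<le> Q * \<bar>u - v\<bar>"
proof (cases "S = {}")
  case True
  then show ?thesis using that[of 1 "\<lambda>_. 0"] by simp
next
  case False
  note basic = sigmoid_properties[OF \<phi>]
  have "\<exists>w. w \<in> {-1..1} \<and> \<phi> w = u" if "u \<in> {-1<..<1}" for u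
    using IVT'[of \<phi> "-1" u 1] basic that by auto
  then obtain \<psi> where \<psi>: "\<And>u. u \<in> {-1<..<1} \<Longrightarrow> \<psi> u \<in> {-1..1}"
      "\<And>u. u \<in> {-1<..<1} \<Longrightarrow> \<phi> (\<psi> u) = u"
    by metis
  obtain a where a: "a \<in> S" "\<And>u. u \<in> S \<Longrightarrow> a \<le> u"
    using compact_attains_inf[OF S(1) False] by blast
  obtain b where b: "b \<in> S" "\<And>u. u \<in> S \<Longrightarrow> u \<le> b"
    using compact_attains_sup[OF S(1) False] by blast
  have ab: "a \<in> {-1<..<1}" "b \<in> {-1<..<1}" using a b S by auto
  have inner: "-1 < \<psi> u" "\<psi> u < 1" if "u \<in> {-1<..<1}" for u
    using \<psi>(1)[OF that] \<psi>(2)[OF that] basic(3,4) that by (auto simp: order_le_less)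
  have mono: "\<psi> u \<le> \<psi> v" if "u \<le> v" "u \<in> {-1<..<1}" "v \<in> {-1<..<1}" for u v
    using monoD[OF basic(7), of "\<psi> v" "\<psi> u"] \<psi> that by (metis dual_order.antisym linorder_le_cases)
  \<comment> \<open>Preimages of points of \<open>S\<close> lie in this interval, whose ends are inside \<open>(-1,1)\<close>.\<close>
  let ?I = "{\<psi> a..\<psi> b}"
  have "?I \<noteq> {}" using mono[OF b(2)[OF a(1)] ab] by simp
  then obtain w where w: "w \<in> ?I" "\<And>z. z \<in> ?I \<Longrightarrow> deriv \<phi> w \<le> deriv \<phi> z"
    using continuous_attains_inf[OF compact_Icc _ basic(6)] by blast
  have pos: "deriv \<phi> w > 0"
    using \<phi> w(1) inner[OF ab(1)] inner[OF ab(2)] by (auto simp: sigmoid_def)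
  have le: "\<psi> v - \<psi> u \<le> (v - u) / deriv \<phi> w" if uv: "u \<in> S" "v \<in> S" "u < v" for u v
  proof (cases "\<psi> u < \<psi> v")
    case True
    have uv': "u \<in> {-1<..<1}" "v \<in> {-1<..<1}" using uv S by auto
    obtain z where z: "\<psi> u < z" "z < \<psi> v" "\<phi> (\<psi> v) - \<phi> (\<psi> u) = (\<psi> v - \<psi> u) * deriv \<phi> z"
      using MVT2[OF True] basic(5) by blast
    have "\<psi> a \<le> \<psi> u" "\<psi> v \<le> \<psi> b" using mono a b ab uv uv' by auto
    then have "deriv \<phi> w \<le> deriv \<phi> z" using z by (intro w(2)) auto
    then have "(\<psi> v - \<psi> u) * deriv \<phi> w \<le> v - u"
      using z True \<psi>(2) uv' by (metis diff_gt_0_iff_gt mult_le_cancel_left_pos)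
    then show ?thesis using pos by (simp add: field_simps)
  next
    case False
    have "0 \<le> (v - u) / deriv \<phi> w" using uv pos by simp
    then show ?thesis using False by linarith
  qed
  have "\<bar>\<psi> u - \<psi> v\<bar> \<le> 1 / deriv \<phi> w * \<bar>u - v\<bar>" if uv: "u \<in> S" "v \<in> S" for u v
  proof -
    have uv': "u \<in> {-1<..<1}" "v \<in> {-1<..<1}" using uv S by auto
    then show ?thesis
      using le[of u v] le[of v u] mono[of u v] mono[of v u] uv
      by (cases u v rule: linorder_cases) auto
  qed
  then show ?thesis using that[of "1 / deriv \<phi> w" \<psi>] pos \<psi> S by (simp add: subset_iff)
qed

section \<open>Convergence to the sliding motion\<close>

theorem theorem2:
  fixes f :: "real ^ 'm \<Rightarrow> real \<Rightarrow> real \<Rightarrow> real ^ 'm"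
    and g :: "real ^ 'm \<Rightarrow> real \<Rightarrow> real \<Rightarrow> real"
    and \<phi> :: "real \<Rightarrow> real"
    and M T :: real
    and x\<^sub>U :: "real \<Rightarrow> real ^ 'm"
  assumes "smooth (\<lambda>(x, y, u). f x y u)"
    and "smooth (\<lambda>(x, y, u). g x y u)"
    and "M > 0"
    and "sliding_assumption g M"
    and "sigmoid \<phi>"
    and "T > 0"
    and "ode_solution_on (utkin_field f g) x\<^sub>U {0..T}"
    and "\<forall>t\<in>{0..T}. norm (x\<^sub>U t) < M"
  shows "\<exists>\<alpha>\<^sub>0>0. \<exists>L>0. \<forall>\<alpha>. 0 < \<alpha> \<and> \<alpha> \<le> \<alpha>\<^sub>0 \<longrightarrow>
    (\<forall>y\<^sub>0\<in>{-\<alpha>..\<alpha>}. \<forall>\<tau> x y.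
       0 < \<tau> \<and> \<tau> \<le> T \<and>
       ode_solution_on (regularized_field f g \<phi> \<alpha>) (\<lambda>t. (x t, y t)) {0..\<tau>} \<and>
       x 0 = x\<^sub>U 0 \<and> y 0 = y\<^sub>0 \<longrightarrow>
       (\<forall>t\<in>{0..\<tau>}. norm (x t - x\<^sub>U t) \<le> L * \<alpha>))"
proof -
  note f = assms(1) and g = assms(2) and sl = assms(2,3,4)
  have xU: "norm (x\<^sub>U t) \<le> M" if "t \<in> {0..T}" for t using assms(8) that by force
  define U where "U t = equivalent_control g (x\<^sub>U t)" for t
  have U: "U t \<in> {-1<..<1}" "g (x\<^sub>U t) 0 (U t) = 0" if "t \<in> {0..T}" for t
    using equivalent_control_sliding[OF sl xU[OF that]] by (simp_all add: U_def)

  obtain c where c: "c > 0"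
    "\<And>x u v. norm x \<le> M \<Longrightarrow> -1 \<le> u \<Longrightarrow> u \<le> v \<Longrightarrow> v \<le> 1 \<Longrightarrow> g x 0 v \<le> g x 0 u - c * (v - u)"
    using sliding_strongly_decreasing[OF sl] by blast

  \<comment> \<open>While \<open>m < 1\<close> and \<open>\<alpha> \<le> 1\<close>, \<open>x\<close> is within 1 of the reference curve and \<open>\<bar>y\<bar> \<le> 1 + \<alpha>\<close>.\<close>
  let ?S = "cball (0 :: real ^ 'm) (M + 1) \<times> {-2..2::real} \<times> {-1..1::real}"
  have S: "compact ?S" "convex ?S" by (auto intro!: compact_Times convex_Times)
  obtain Kf where Kf: "Kf > 0" "\<And>p q. p \<in> ?S \<Longrightarrow> q \<in> ?S \<Longrightarrow>
      norm ((\<lambda>(x, y, u). f x y u) p - (\<lambda>(x, y, u). f x y u) q) \<le> Kf * norm (p - q)"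
    using smooth_imp_lipschitz_on_compact_convex[OF f S] by metis
  obtain Kg where Kg: "Kg > 0" "\<And>p q. p \<in> ?S \<Longrightarrow> q \<in> ?S \<Longrightarrow>
      norm ((\<lambda>(x, y, u). g x y u) p - (\<lambda>(x, y, u). g x y u) q) \<le> Kg * norm (p - q)"
    using smooth_imp_lipschitz_on_compact_convex[OF g S] by metis
  define K where "K = max Kf Kg"
  have K: "K > 0" using Kf(1) by (simp add: K_def)
  have near: "norm (f x y v - f x' 0 u) \<le> K * (norm (x - x') + \<bar>y\<bar> + \<bar>v - u\<bar>)"
    "\<bar>g x y v - g x' 0 u\<bar> \<le> K * (norm (x - x') + \<bar>y\<bar> + \<bar>v - u\<bar>)"
    if "norm x \<le> M + 1" "norm x' \<le> M" "\<bar>y\<bar> \<le> 2" "v \<in> {-1..1}" "u \<in> {-1..1}" for x y v x' u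
  proof -
    have mem: "(x, y, v) \<in> ?S" "(x', 0, u) \<in> ?S" using that by auto
    have "norm ((x, y, v) - (x', 0, u)) \<le> norm (x - x') + norm (y, v - u)"
      using norm_Pair_le[of "x - x'" "(y, v - u)"] by simp
    also have "\<dots> \<le> norm (x - x') + \<bar>y\<bar> + \<bar>v - u\<bar>"
      using norm_Pair_le[of y "v - u"] by simp
    finally have le: "norm ((x, y, v) - (x', 0, u)) \<le> norm (x - x') + \<bar>y\<bar> + \<bar>v - u\<bar>" .
    have grow: "k * norm ((x, y, v) - (x', 0, u)) \<le> K * (norm (x - x') + \<bar>y\<bar> + \<bar>v - u\<bar>)"
      if "k \<le> K" for k
      using that K by (intro mult_mono le) simp_all
    have "Kf \<le> K" "Kg \<le> K" by (simp_all add: K_def)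
    then show "norm (f x y v - f x' 0 u) \<le> K * (norm (x - x') + \<bar>y\<bar> + \<bar>v - u\<bar>)"
      "\<bar>g x y v - g x' 0 u\<bar> \<le> K * (norm (x - x') + \<bar>y\<bar> + \<bar>v - u\<bar>)"
      using order_trans[OF Kf(2)[OF mem] grow] order_trans[OF Kg(2)[OF mem] grow] by simp_all
  qed

  obtain C where C: "\<And>p. p \<in> ?S \<Longrightarrow> norm ((\<lambda>(x, y, u). f x y u) p) \<le> C"
    using compact_imp_bounded[OF compact_continuous_image[OF smooth_imp_continuous_on[OF f] S(1)]]
    unfolding bounded_iff by (metis imageI)
  have xU_deriv: "(x\<^sub>U has_vector_derivative f (x\<^sub>U t) 0 (U t)) (at t within {0..T})"
    if "t \<in> {0..T}" for t
    using assms(7) that by (simp add: ode_solution_on_def utkin_field_def U_def)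
  have xU_lip: "norm (x\<^sub>U s - x\<^sub>U t) \<le> C * \<bar>s - t\<bar>" if "s \<in> {0..T}" "t \<in> {0..T}" for s t
  proof (rule lipschitz_if_bounded_derivative[OF xU_deriv _ that])
    fix t assume t: "t \<in> {0..T}"
    then have "(x\<^sub>U t, 0, U t) \<in> ?S" using xU[OF t] U(1)[OF t] by auto
    from C[OF this] show "norm (f (x\<^sub>U t) 0 (U t)) \<le> C" by simp
  qed

  obtain Q where Q: "Q > 0" "\<And>x x'. norm x \<le> M \<Longrightarrow> norm x' \<le> M \<Longrightarrow>
      \<bar>equivalent_control g x - equivalent_control g x'\<bar> \<le> Q * norm (x - x')"
    using equivalent_control_lipschitz[OF sl] by metis
  have U_lip: "\<bar>U s - U t\<bar> \<le> Q * C * \<bar>s - t\<bar>" if "s \<in> {0..T}" "t \<in> {0..T}" for s t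
  proof -
    have "\<bar>U s - U t\<bar> \<le> Q * norm (x\<^sub>U s - x\<^sub>U t)" unfolding U_def using that by (intro Q(2) xU)
    also have "\<dots> \<le> Q * (C * \<bar>s - t\<bar>)" using Q(1) xU_lip[OF that] by (intro mult_left_mono) auto
    finally show ?thesis by simp
  qed
  have C0: "C \<ge> 0"
    using order_trans[OF norm_ge_zero C[of "(0, 0, 0)"]] assms(3) by simp
  have "continuous_on {0..T} U"
    by (rule lipschitz_on_continuous_on[of "Q * C"])
      (use U_lip Q(1) C0 in \<open>auto simp: lipschitz_on_def dist_real_def\<close>)
  then have U_compact: "compact (U ` {0..T})" by (rule compact_continuous_image) simp
  have U_inside: "U ` {0..T} \<subseteq> {-1<..<1}" using U(1) by blast
  obtain \<psi> P where P: "P > 0"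
    and \<psi>: "\<And>u. u \<in> U ` {0..T} \<Longrightarrow> \<psi> u \<in> {-1..1}" "\<And>u. u \<in> U ` {0..T} \<Longrightarrow> \<phi> (\<psi> u) = u"
    and \<psi>_lip: "\<And>u v. u \<in> U ` {0..T} \<Longrightarrow> v \<in> U ` {0..T} \<Longrightarrow> \<bar>\<psi> u - \<psi> v\<bar> \<le> P * \<bar>u - v\<bar>"
    by (rule sigmoid_lipschitz_inverse[OF assms(5) U_compact U_inside]) (rule that)
  define W where "W t = \<psi> (U t)" for t
  define R where "R = P * (Q * C)"
  have R: "R \<ge> 0" using P Q(1) C0 by (simp add: R_def)
  have W: "\<bar>W t\<bar> \<le> 1" "\<phi> (W t) = U t" if "t \<in> {0..T}" for t
    using \<psi>[of "U t"] that by (auto simp: W_def)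
  have W_lip: "\<bar>W s - W t\<bar> \<le> R * \<bar>s - t\<bar>" if "s \<in> {0..T}" "t \<in> {0..T}" for s t
  proof -
    have "\<bar>W s - W t\<bar> \<le> P * \<bar>U s - U t\<bar>" unfolding W_def using that by (intro \<psi>_lip) auto
    also have "\<dots> \<le> P * (Q * C * \<bar>s - t\<bar>)" using P U_lip[OF that] by (intro mult_left_mono) auto
    finally show ?thesis by (simp add: R_def)
  qed

  \<comment> \<open>The weight for which the attraction outweighs the effect of a wrong control on \<open>x\<close>:
    \<open>A * c \<ge> K\<close>. The condition \<open>A \<ge> 1\<close> lets \<open>m\<close> also control \<open>y\<close>.\<close>
  define A where "A = K / c + 1"
  have A: "A \<ge> 1" "K \<le> A * c" using K c(1) by (simp_all add: A_def field_simps)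
  define \<Lambda> where "\<Lambda> = K * (1 + A)"
  \<comment> \<open>The final 1 pays for the slack in the two first-order expansions.\<close>
  define B where "B = K * (1 + A) + A * R + 1"
  have \<Lambda>: "\<Lambda> \<ge> 0" and B: "B \<ge> 0" using K A R by (simp_all add: \<Lambda>_def B_def)
  define L where "L = (2 * A + B * T) * exp (\<Lambda> * T)"
  have L: "L > 0" using A B assms(6) by (simp add: L_def add_pos_nonneg)

  have main: "norm (x t - x\<^sub>U t) \<le> L * \<alpha>"
    if \<alpha>: "0 < \<alpha>" "\<alpha> \<le> 1" "L * \<alpha> < 1" and y0: "\<bar>y 0\<bar> \<le> \<alpha>" and \<tau>: "0 < \<tau>" "\<tau> \<le> T"
      and ode: "ode_solution_on (regularized_field f g \<phi> \<alpha>) (\<lambda>t. (x t, y t)) {0..\<tau>}"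
      and x0: "x 0 = x\<^sub>U 0" and t: "t \<in> {0..\<tau>}"
    for \<alpha> \<tau> x y t
  proof -
    define v where "v t = \<phi> (y t / \<alpha>)" for t
    have pair: "((\<lambda>t. (x t, y t)) has_vector_derivative (f (x t) (y t) (v t), g (x t) (y t) (v t)))
        (at t within {0..\<tau>})" if "t \<in> {0..\<tau>}" for t
      using ode that by (simp add: ode_solution_on_def regularized_field_def v_def)
    have x_deriv: "(x has_vector_derivative f (x t) (y t) (v t)) (at t within {0..\<tau>})"
      and y_deriv: "(y has_vector_derivative g (x t) (y t) (v t)) (at t within {0..\<tau>})"
      if "t \<in> {0..\<tau>}" for t
      using bounded_linear.has_vector_derivative[OF bounded_linear_fst pair[OF that]]
        bounded_linear.has_vector_derivative[OF bounded_linear_snd pair[OF that]] by simp_all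
    define m where "m t = norm (x t - x\<^sub>U t) + A * \<bar>y t - \<alpha> * W t\<bar>" for t
    have "m t \<le> (2 * A * \<alpha> + B * \<alpha> * t) * exp (\<Lambda> * t)"
    proof (rule dini_gronwall[where R = 1 and \<tau> = \<tau>])
      have "continuous_on {0..\<tau>} x" "continuous_on {0..\<tau>} y"
        using x_deriv y_deriv by (meson continuous_on_eq_continuous_within has_vector_derivative_continuous)+
      moreover have "continuous_on {0..\<tau>} x\<^sub>U"
      proof -
        have "continuous_on {0..T} x\<^sub>U"
          using xU_deriv by (meson continuous_on_eq_continuous_within has_vector_derivative_continuous)
        then show ?thesis by (rule continuous_on_subset) (use \<tau> in auto)
      qed
      moreover have "continuous_on {0..\<tau>} W"
        by (rule lipschitz_on_continuous_on[of R])
          (use W_lip R \<tau> in \<open>auto simp: lipschitz_on_def dist_real_def\<close>)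
      ultimately show "continuous_on {0..\<tau>} m"
        unfolding m_def by (intro continuous_intros)
      show "0 \<le> B * \<alpha>" "0 \<le> 2 * A * \<alpha>" using A B \<alpha> by simp_all
      have "\<bar>\<alpha> * W 0\<bar> \<le> \<alpha>" using W(1)[of 0] assms(6) \<alpha> by (simp add: abs_mult)
      then have "\<bar>y 0 - \<alpha> * W 0\<bar> \<le> 2 * \<alpha>"
        using y0 by linarith
      then have "A * \<bar>y 0 - \<alpha> * W 0\<bar> \<le> A * (2 * \<alpha>)" using A by (intro mult_left_mono) auto
      then show "m 0 \<le> 2 * A * \<alpha>" by (simp add: m_def x0)
      have "(2 * A * \<alpha> + B * \<alpha> * \<tau>) * exp (\<Lambda> * \<tau>) \<le> (2 * A * \<alpha> + B * \<alpha> * T) * exp (\<Lambda> * T)"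
        using \<tau> A B \<alpha> \<Lambda> by (intro mult_mono add_left_mono) (auto intro: mult_left_mono)
      also have "\<dots> = L * \<alpha>" by (simp add: L_def algebra_simps)
      finally show "(2 * A * \<alpha> + B * \<alpha> * \<tau>) * exp (\<Lambda> * \<tau>) < 1" using \<alpha> by simp
    next
      fix t assume t: "0 \<le> t" "t < \<tau>" "m t < 1"
      have tT: "t \<in> {0..T}" and sub: "{t..\<tau>} \<subseteq> {0..\<tau>}" "{t..\<tau>} \<subseteq> {0..T}" using t \<tau> by auto
      let ?p = "y t - \<alpha> * W t" and ?e = "x t - x\<^sub>U t"
      define \<beta> where "\<beta> = K * (m t + \<alpha>) - c * \<bar>v t - U t\<bar>"
      have pA: "\<bar>?p\<bar> \<le> A * \<bar>?p\<bar>" using mult_right_mono[OF A(1), of "\<bar>?p\<bar>"] by simp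
      have "\<bar>\<alpha> * W t\<bar> \<le> \<alpha>" using W(1)[OF tT] \<alpha> by (simp add: abs_mult)
      then have "\<bar>y t\<bar> \<le> \<bar>?p\<bar> + \<alpha>" by linarith
      then have small: "norm ?e + \<bar>y t\<bar> \<le> m t + \<alpha>" using pA by (simp add: m_def)
      have "norm ?e \<le> m t" using A by (simp add: m_def)
      then have xM: "norm (x t) \<le> M + 1"
        using xU[OF tT] t(3) norm_triangle_sub[of "x t" "x\<^sub>U t"] by linarith
      have y2: "\<bar>y t\<bar> \<le> 2" using small t(3) \<alpha> norm_ge_zero[of ?e] by linarith
      have v1: "v t \<in> {-1..1}" unfolding v_def by (rule sigmoid_properties(1)[OF assms(5)])
      have U1: "U t \<in> {-1..1}" using U(1)[OF tT] by auto
      have scale: "K * (norm ?e + \<bar>y t\<bar>) \<le> K * (m t + \<alpha>)"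
        using small K by (intro mult_left_mono) auto

      have dx: "norm (f (x t) (y t) (v t) - f (x\<^sub>U t) 0 (U t)) \<le> K * (m t + \<alpha>) + K * \<bar>v t - U t\<bar>"
        using near(1)[OF xM xU[OF tT] y2 v1 U1] scale by (simp add: distrib_left)
      \<comment> \<open>The control \<open>v t\<close> is kept here, so that the comparison does not involve \<open>\<bar>v t - U t\<bar>\<close>.\<close>
      have dy: "\<bar>g (x t) (y t) (v t) - g (x\<^sub>U t) 0 (v t)\<bar> \<le> K * (m t + \<alpha>)"
        using near(2)[OF xM xU[OF tT] y2 v1 v1] scale by simp

      have x_dini: "\<forall>\<^sub>F s in at_right t. norm (x s - x\<^sub>U s) \<le>
          norm ?e + (K * (m t + \<alpha>) + K * \<bar>v t - U t\<bar> + \<alpha> / 2) * (s - t)"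
      proof (rule norm_eventually_le_at_right[where \<tau> = \<tau>])
        show "((\<lambda>s. x s - x\<^sub>U s) has_vector_derivative
            f (x t) (y t) (v t) - f (x\<^sub>U t) 0 (U t)) (at t within {t..\<tau>})"
          using has_vector_derivative_within_subset[OF x_deriv sub(1)]
            has_vector_derivative_within_subset[OF xU_deriv[OF tT] sub(2)] t
          by (intro has_vector_derivative_diff) auto
      qed (use t \<alpha> dx in auto)

      have y_dini: "\<forall>\<^sub>F s in at_right t. \<bar>y s - \<alpha> * W s\<bar> \<le>
          \<bar>?p\<bar> + (\<beta> + \<alpha> * R + \<alpha> / (2 * A)) * (s - t)"
      proof (rule abs_diff_eventually_le_at_right[where \<tau> = \<tau>])
        show "(y has_vector_derivative g (x t) (y t) (v t)) (at t within {t..\<tau>})"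
          using has_vector_derivative_within_subset[OF y_deriv sub(1)] t by auto
        show "\<bar>\<alpha> * W s - \<alpha> * W t\<bar> \<le> \<alpha> * R * (s - t)" if "s \<in> {t..\<tau>}" for s
        proof -
          have "\<bar>\<alpha> * W s - \<alpha> * W t\<bar> = \<alpha> * \<bar>W s - W t\<bar>"
            using \<alpha> by (simp add: abs_mult flip: right_diff_distrib)
          also have "\<dots> \<le> \<alpha> * (R * \<bar>s - t\<bar>)"
            using \<alpha> sub that tT by (intro mult_left_mono W_lip) auto
          finally show ?thesis using that by simp
        qed
        have mono: "mono \<phi>" by (rule sigmoid_properties(7)[OF assms(5)])
        {
          assume "\<alpha> * W t < y t"
          then have "W t \<le> y t / \<alpha>" using \<alpha> by (simp add: field_simps)
          then have "U t \<le> v t" using monoD[OF mono] W(2)[OF tT] by (metis v_def)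
          moreover from this have "g (x\<^sub>U t) 0 (v t) \<le> - c * (v t - U t)"
            using c(2)[OF xU[OF tT], of "U t" "v t"] U(2)[OF tT] U1 v1 by simp
          ultimately show "g (x t) (y t) (v t) \<le> \<beta>" using dy by (simp add: \<beta>_def)
        next
          assume "y t < \<alpha> * W t"
          then have "y t / \<alpha> \<le> W t" using \<alpha> by (simp add: field_simps)
          then have "v t \<le> U t" using monoD[OF mono] W(2)[OF tT] by (metis v_def)
          moreover from this have "c * (U t - v t) \<le> g (x\<^sub>U t) 0 (v t)"
            using c(2)[OF xU[OF tT], of "v t" "U t"] U(2)[OF tT] U1 v1 by simp
          ultimately show "- g (x t) (y t) (v t) \<le> \<beta>" using dy by (simp add: \<beta>_def)
        next
          assume "y t = \<alpha> * W t"
          then have "v t = U t" using \<alpha> W(2)[OF tT] by (simp add: v_def)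
          then show "\<bar>g (x t) (y t) (v t)\<bar> \<le> \<beta>" using dy U(2)[OF tT] by (simp add: \<beta>_def)
        }
      qed (use t \<alpha> A in auto)

      show "\<forall>\<^sub>F s in at_right t. m s \<le> m t + (\<Lambda> * m t + B * \<alpha>) * (s - t)"
        using x_dini y_dini eventually_at_right_less[of t]
      proof eventually_elim
        case (elim s)
        \<comment> \<open>The two contributions of the control error cancel by the choice of \<open>A\<close>.\<close>
        have "K * \<bar>v t - U t\<bar> \<le> A * c * \<bar>v t - U t\<bar>" using A by (intro mult_right_mono) auto
        then have rate: "K * (m t + \<alpha>) + K * \<bar>v t - U t\<bar> + \<alpha> / 2 + A * (\<beta> + \<alpha> * R + \<alpha> / (2 * A))
            \<le> \<Lambda> * m t + B * \<alpha>"
          using A by (simp add: \<beta>_def \<Lambda>_def B_def algebra_simps)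
        have "A * \<bar>y s - \<alpha> * W s\<bar> \<le> A * (\<bar>?p\<bar> + (\<beta> + \<alpha> * R + \<alpha> / (2 * A)) * (s - t))"
          using elim A by (intro mult_left_mono) auto
        then have "m s \<le> m t + (K * (m t + \<alpha>) + K * \<bar>v t - U t\<bar> + \<alpha> / 2
            + A * (\<beta> + \<alpha> * R + \<alpha> / (2 * A))) * (s - t)"
          using elim by (simp only: m_def distrib_left distrib_right mult.assoc)
        also have "\<dots> \<le> m t + (\<Lambda> * m t + B * \<alpha>) * (s - t)"
          using rate elim by (intro add_left_mono mult_right_mono) auto
        finally show ?case .
      qed
    qed (use \<Lambda> t in auto)
    also have "\<dots> \<le> (2 * A * \<alpha> + B * \<alpha> * T) * exp (\<Lambda> * T)"
      using \<tau> t A B \<alpha> \<Lambda> by (intro mult_mono add_left_mono) (auto intro: mult_left_mono)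
    also have "\<dots> = L * \<alpha>" by (simp add: L_def algebra_simps)
    finally have "m t \<le> L * \<alpha>" .
    moreover have "norm (x t - x\<^sub>U t) \<le> m t" using A by (simp add: m_def)
    ultimately show ?thesis by linarith
  qed
  show ?thesis
  proof (rule exI[of _ "min 1 (1 / (2 * L))"], rule conjI, use L in simp,
      rule exI[of _ L], intro conjI allI impI ballI)
    fix \<alpha> y\<^sub>0 \<tau> x y t
    assume \<alpha>: "0 < \<alpha> \<and> \<alpha> \<le> min 1 (1 / (2 * L))" and "y\<^sub>0 \<in> {-\<alpha>..\<alpha>}"
      and "0 < \<tau> \<and> \<tau> \<le> T \<and>
       ode_solution_on (regularized_field f g \<phi> \<alpha>) (\<lambda>t. (x t, y t)) {0..\<tau>} \<and>
       x 0 = x\<^sub>U 0 \<and> y 0 = y\<^sub>0" and "t \<in> {0..\<tau>}"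
    moreover have "L * \<alpha> < 1"
    proof -
      have "L * \<alpha> \<le> 1 / 2" using \<alpha> L by (simp add: field_simps)
      then show ?thesis by linarith
    qed
    ultimately show "norm (x t - x\<^sub>U t) \<le> L * \<alpha>"
      by (intro main[of \<alpha> y \<tau> x t]) auto
  qed (use L in auto)
qed

end
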